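(* For every infinite cardinal $\kappa$, the space $[0,1]^\kappa$ is not $\kappa$-Corson compact.
   Context: For an infinite cardinal $\kappa$ and a set $\Gamma$, $\Sigma_\kappa(\mathbb{R}^\Gamma)=\{x\in\mathbb{R}^\Gamma:\ |\{\gamma\in\Gamma:x(\gamma)\neq0\}|<\kappa\}$ with the topology inherited from the product. A compact (Hausdorff) space is $\kappa$-Corson compact if it is homeomorphic to a subset of $\Sigma_\kappa(\mathbb{R}^\Gamma)$ for some set $\Gamma$. *)

theory Defs
  imports "HOL-Analysis.Analysis"
begin

unbundle cardinal_syntax

text \<open>
  A cardinal \<open>\<kappa>\<close> is a \<^const>\<open>Card_order\<close> relation; its underlying set is \<open>Field \<kappa>\<close>, and
  \<open>|A| <o \<kappa>\<close> compares cardinalities across types. The space \<open>\<real>\<^sup>\<Gamma>\<close> is the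
  \<^const>\<open>product_topology\<close>, whose points are extensional functions (\<open>undefined\<close> off \<open>\<Gamma>\<close>).
\<close>

definition Sigma_set :: "'k rel \<Rightarrow> 'g set \<Rightarrow> ('g \<Rightarrow> real) set" where
  "Sigma_set \<kappa> \<Gamma> = {x \<in> \<Gamma> \<rightarrow>\<^sub>E UNIV. |{\<gamma> \<in> \<Gamma>. x \<gamma> \<noteq> 0}| <o \<kappa>}"

definition Sigma_space :: "'k rel \<Rightarrow> 'g set \<Rightarrow> ('g \<Rightarrow> real) topology" where
  "Sigma_space \<kappa> \<Gamma> = subtopology (product_topology (\<lambda>_. euclideanreal) \<Gamma>) (Sigma_set \<kappa> \<Gamma>)"

text \<open>
  HOL cannot quantify over types inside a formula, so the type \<open>'g\<close> from which \<open>\<Gamma>\<close> is taken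
  is a parameter. ``Not \<open>\<kappa>\<close>-Corson compact'' is the negation for every type \<open>'g\<close>, so \<open>'g\<close> must
  be left as a free type variable there.
\<close>

definition kappa_Corson_compact :: "'g itself \<Rightarrow> 'k rel \<Rightarrow> 'a topology \<Rightarrow> bool" where
  "kappa_Corson_compact (_ :: 'g itself) \<kappa> X \<longleftrightarrow>
     compact_space X \<and> Hausdorff_space X \<and>
     (\<exists>(\<Gamma> :: 'g set) S. S \<subseteq> Sigma_set \<kappa> \<Gamma> \<and>
        X homeomorphic_space subtopology (Sigma_space \<kappa> \<Gamma>) S)"

definition unit_cube :: "'i set \<Rightarrow> ('i \<Rightarrow> real) topology" where
  "unit_cube I = product_topology (\<lambda>_. top_of_set {0..1}) I"

end

theory Submission
  imports Defs "HOL-Homology.Invariance_of_Domain"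
begin

text \<open>
  Suppose \<open>h\<close> embeds the cube into \<open>\<Sigma>\<^sub>\<kappa>(\<real>\<^sup>\<Gamma>)\<close>. If \<open>h z\<close> is nonzero at \<open>\<gamma>\<close>, then
  this is witnessed by finitely many coordinates of \<open>z\<close>. Use Zorn's lemma to choose a maximal
  compatible family of such witnesses for distinct \<open>\<gamma>\<close>, and let \<open>T\<close> be the set of these \<open>\<gamma>\<close>.
  A point agreeing with all the witnesses has support containing \<open>T\<close>, so \<open>|T| < \<kappa>\<close>, and the
  witnesses fix only a set \<open>D\<close> of fewer than \<open>\<kappa>\<close> coordinates. By maximality every point extending
  them has support exactly \<open>T\<close>, so \<open>h\<close> embeds a cube of dimension \<open>\<kappa>\<close> into \<open>\<real>\<^sup>T\<close>. If \<open>T\<close> is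
  infinite, the image of a point depends on at most \<open>|T|\<close> of its coordinates, which
  contradicts injectivity; if \<open>T\<close> is finite, invariance of domain gives the contradiction.
\<close>

section \<open>Finite dependence in cubes, and unions of few finite sets\<close>

lemma topspace_unit_cube: "topspace (unit_cube I) = I \<rightarrow>\<^sub>E {0..1}"
  by (simp add: unit_cube_def)

lemma unit_cube_mem: "\<lbrakk>z \<in> topspace (unit_cube I); i \<in> I\<rbrakk> \<Longrightarrow> z i \<in> {0..1}"
  unfolding topspace_unit_cube by (rule PiE_mem)

text \<open>The preimage of the \<open>e\<close>-ball around \<open>f z\<close> contains a basic
  open box around \<open>z\<close>, and such a box restricts only finitely many coordinates; these
  form \<open>F\<close>.\<close>

lemma unit_cube_finite_dependence:
  assumes f: "continuous_map (unit_cube I) euclideanreal f"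
    and z: "z \<in> topspace (unit_cube I)" and "e > 0"
  shows "\<exists>F. finite F \<and> F \<subseteq> I \<and>
    (\<forall>w\<in>topspace (unit_cube I). (\<forall>i\<in>F. w i = z i) \<longrightarrow> \<bar>f w - f z\<bar> < e)"
proof -
  let ?U = "{w \<in> topspace (unit_cube I). f w \<in> ball (f z) e}"
  have "openin (unit_cube I) ?U"
    by (rule openin_continuous_map_preimage[OF f]) simp
  moreover have "z \<in> ?U"
    using z \<open>e > 0\<close> by simp
  ultimately have "\<exists>X. z \<in> (\<Pi>\<^sub>E i\<in>I. X i) \<and> (\<forall>i. openin (top_of_set {0..1::real}) (X i)) \<and>
      finite {i. X i \<noteq> topspace (top_of_set {0..1::real})} \<and> (\<Pi>\<^sub>E i\<in>I. X i) \<subseteq> ?U"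
    unfolding unit_cube_def by (rule product_topology_open_contains_basis)
  then obtain X where X: "z \<in> (\<Pi>\<^sub>E i\<in>I. X i)"
      "finite {i. X i \<noteq> topspace (top_of_set {0..1::real})}" "(\<Pi>\<^sub>E i\<in>I. X i) \<subseteq> ?U"
    by blast
  let ?F = "{i \<in> I. X i \<noteq> {0..1}}"
  have "finite ?F"
    by (rule finite_subset[OF _ X(2)]) auto
  moreover have "\<bar>f w - f z\<bar> < e"
    if w: "w \<in> topspace (unit_cube I)" and eq: "\<forall>i\<in>?F. w i = z i" for w
  proof -
    have "w i \<in> X i" if "i \<in> I" for i
    proof (cases "X i = {0..1}")
      case True
      then show ?thesis
        using unit_cube_mem[OF w that] by simp
    next
      case False
      then show ?thesis
        using eq that PiE_mem[OF X(1) that] by simp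
    qed
    then have "w \<in> (\<Pi>\<^sub>E i\<in>I. X i)"
      using w by (auto simp: topspace_unit_cube PiE_def)
    then show ?thesis
      using X(3) by (auto simp: dist_real_def)
  qed
  ultimately show ?thesis
    by blast
qed

text \<open>For infinite \<open>A\<close> the union has size at most \<open>|A|\<close>, and for
  finite \<open>A\<close> it is finite. Since the members are finite, this works for singular
  \<open>|I|\<close> too.\<close>

lemma card_of_Union_finite_ordLess:
  assumes I: "infinite I" and A: "|A| <o |I|" and fin: "\<And>a. a \<in> A \<Longrightarrow> finite (F a)"
  shows "|\<Union>a\<in>A. F a| <o |I|"
proof (cases "finite A")
  case True
  then show ?thesis
    using fin I by (intro finite_ordLess_infinite2) auto
next
  case False
  then have "\<forall>a\<in>A. |F a| \<le>o |A|"
    using fin by (metis finite_ordLess_infinite2 ordLess_imp_ordLeq)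
  then have "|\<Union>a\<in>A. F a| \<le>o |A|"
    using card_of_UNION_ordLeq_infinite[OF False ordLeq_reflexive]
    by (metis card_of_Card_order card_order_on_def)
  then show ?thesis
    using A ordLeq_ordLess_trans by blast
qed

section \<open>Subcubes cannot be embedded into products of few lines\<close>

text \<open>Padding an injective \<open>f\<close> with a zero coordinate would give a continuous
  injection of (n+1)-space into itself. Its image would be open by invariance of domain, yet it lies
  in a hyperplane.\<close>

lemma no_continuous_injection_Euclidean_space_Suc:
  assumes f: "\<And>j. j < n \<Longrightarrow> continuous_map (Euclidean_space (Suc n)) euclideanreal (\<lambda>x. f x j)"
  shows "\<exists>x\<in>topspace (Euclidean_space (Suc n)). \<exists>y\<in>topspace (Euclidean_space (Suc n)).
    x \<noteq> y \<and> (\<forall>j<n. f x j = f y j)"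
proof (rule ccontr)
  assume neg: "\<not> ?thesis"
  let ?E = "Euclidean_space (Suc n)"
  define g where "g = (\<lambda>x j. if j < n then f x j else (0::real))"
  have "inj_on g (topspace ?E)"
  proof (rule inj_onI)
    fix x y assume xy: "x \<in> topspace ?E" "y \<in> topspace ?E" "g x = g y"
    then have "\<forall>j<n. f x j = f y j"
      unfolding g_def by metis
    then show "x = y"
      using xy neg by blast
  qed
  moreover have "continuous_map ?E ?E g"
  proof -
    have "continuous_map ?E ?E (\<lambda>x j. if j < Suc n then g x j else 0)"
      unfolding continuous_map_componentwise_Euclidean_space g_def
      using f by (auto simp: less_Suc_eq)
    then show ?thesis
      by (rule continuous_map_eq) (auto simp: g_def fun_eq_iff)
  qed
  ultimately have op: "openin ?E (g ` topspace ?E)"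
    by (intro invariance_of_domain_Euclidean_space) auto
  define p where "p = g (\<lambda>_. 0)"
  have p: "p \<in> g ` topspace ?E"
    by (auto simp: p_def topspace_Euclidean_space)
  \<comment> \<open>\<open>q\<close> is the line through \<open>p\<close> orthogonal to that
    hyperplane. It meets the image only at parameter 0, so openness of the image would make a
    singleton open in the reals.\<close>
  define q where "q = (\<lambda>t::real. \<lambda>i. if i < Suc n then (if i = n then t else p i) else 0)"
  have "continuous_map euclideanreal ?E q"
    unfolding q_def continuous_map_componentwise_Euclidean_space by auto
  then have "openin euclideanreal {t \<in> topspace euclideanreal. q t \<in> g ` topspace ?E}"
    using op by (rule openin_continuous_map_preimage)
  moreover have "{t \<in> topspace euclideanreal. q t \<in> g ` topspace ?E} = {0}"
  proof -
    have "t = 0" if "q t \<in> g ` topspace ?E" for t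
    proof -
      have "q t n = 0" using that by (auto simp: g_def)
      then show ?thesis by (simp add: q_def)
    qed
    moreover have "q 0 = p"
      by (auto simp: q_def p_def g_def fun_eq_iff)
    ultimately show ?thesis
      using p by auto
  qed
  ultimately show False
    using not_open_singleton[of "0::real"] by simp
qed

text \<open>Infinitely many free coordinates leave room for a copy of Euclidean space of dimension
  one more than \<open>card T\<close>, on which the preceding lemma applies.\<close>

lemma subcube_not_injective_finite:
  assumes z: "z \<in> topspace (unit_cube I)" and K: "K \<subseteq> I" "infinite K" and T: "finite T"
    and h: "\<And>t. t \<in> T \<Longrightarrow> continuous_map (unit_cube I) euclideanreal (\<lambda>w. h w t)"
  shows "\<exists>u\<in>topspace (unit_cube I). \<exists>v\<in>topspace (unit_cube I).
    u \<noteq> v \<and> (\<forall>i\<in>I - K. u i = z i \<and> v i = z i) \<and> (\<forall>t\<in>T. h u t = h v t)"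
proof -
  define n where "n = card T"
  obtain b where b: "bij_betw b {0..<n} T"
    using ex_bij_betw_nat_finite[OF T] n_def by auto
  obtain e :: "nat \<Rightarrow> _" where e: "inj e" "range e \<subseteq> K"
    using infinite_countable_subset[OF K(2)] by auto
  \<comment> \<open>A continuous injection of the line into the unit interval, so that all of
    Euclidean space can be mapped into the cube.\<close>
  define s where "s = (\<lambda>x::real. 1 / (1 + exp x))"
  have s01: "s x \<in> {0..1}" for x
  proof -
    have "0 < 1 + exp x"
      by (simp add: add_pos_pos)
    then show ?thesis
      by (simp add: s_def divide_le_eq_1_pos)
  qed
  have sinj: "x = y" if "s x = s y" for x y
  proof -
    have "1 + exp x \<noteq> 0" "1 + exp y \<noteq> 0"
      by (smt (verit) exp_gt_zero)+
    then show ?thesis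
      using that by (auto simp: s_def divide_simps)
  qed
  have scont: "continuous_map euclideanreal euclideanreal s"
    unfolding s_def continuous_map_iff_continuous2
    by (intro continuous_intros) (smt (verit) exp_gt_zero)
  let ?E = "Euclidean_space (Suc n)"
  \<comment> \<open>Points of \<open>?E\<close> vanish at indices above \<open>n\<close>, so only
    the coordinates \<open>e 0\<close> to \<open>e n\<close> vary; the others in
    \<open>range e\<close> stay at \<open>s 0\<close>.\<close>
  define W where "W = (\<lambda>x::nat \<Rightarrow> real. \<lambda>i\<in>I. if i \<in> range e then s (x (the_inv e i)) else z i)"
  have WC: "W x \<in> topspace (unit_cube I)" for x
    unfolding W_def topspace_unit_cube using s01 unit_cube_mem[OF z] by (auto simp del: atLeastAtMost_iff)
  have proj: "continuous_map ?E euclideanreal (\<lambda>x. x k)" for k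
    unfolding Euclidean_space_def
    by (intro continuous_map_from_subtopology continuous_map_product_projection) simp
  have Wcont: "continuous_map ?E (unit_cube I) W"
    unfolding unit_cube_def continuous_map_componentwise
  proof (intro conjI ballI)
    show "W ` topspace ?E \<subseteq> extensional I"
      by (auto simp: W_def)
    fix k assume k: "k \<in> I"
    have "continuous_map ?E euclideanreal (\<lambda>x. W x k)"
    proof (cases "k \<in> range e")
      case True
      have "continuous_map ?E euclideanreal (s \<circ> (\<lambda>x. x (the_inv e k)))"
        by (rule continuous_map_compose[OF proj scont])
      then show ?thesis
        using k True by (simp add: W_def o_def)
    next
      case False
      then show ?thesis
        using k by (simp add: W_def)
    qed
    moreover have "W x k \<in> {0..1}" for x
      using WC k by (rule unit_cube_mem)
    ultimately show "continuous_map ?E (top_of_set {0..1}) (\<lambda>x. W x k)"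
      by (auto simp: continuous_map_in_subtopology)
  qed
  have "continuous_map ?E euclideanreal (\<lambda>x. h (W x) (b j))" if "j < n" for j
  proof -
    have "b j \<in> T"
      using b that by (auto simp: bij_betw_def)
    from continuous_map_compose[OF Wcont h[OF this]] show ?thesis
      by (simp add: o_def)
  qed
  then obtain x y where xy: "x \<in> topspace ?E" "y \<in> topspace ?E" "x \<noteq> y"
      "\<forall>j<n. h (W x) (b j) = h (W y) (b j)"
    using no_continuous_injection_Euclidean_space_Suc[of n "\<lambda>x j. h (W x) (b j)"] by auto
  obtain j where j: "x j \<noteq> y j"
    using xy(3) by auto
  have "W x (e j) = s (x j)" "W y (e j) = s (y j)"
    using e K by (auto simp: W_def the_inv_f_f)
  then have "W x \<noteq> W y"
    using j sinj by metis
  moreover have "W x i = z i" if "i \<in> I - K" for x i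
    using that e by (auto simp: W_def)
  moreover have "h (W x) t = h (W y) t" if "t \<in> T" for t
    using that b xy(4) by (auto simp: bij_betw_def)
  ultimately show ?thesis
    using WC by blast
qed

text \<open>At \<open>z\<close>, each \<open>h w t\<close> is determined by countably many
  coordinates: finitely many for every tolerance 1/(n+1). As \<open>T\<close> is infinite, all of
  these together number at most \<open>|T|\<close>, so some coordinate outside them and
  \<open>D\<close> can be changed freely.\<close>

lemma subcube_not_injective_infinite:
  assumes z: "z \<in> topspace (unit_cube I)" and I: "infinite I" and D: "|D| <o |I|"
    and T: "infinite T" "|T| <o |I|"
    and h: "\<And>t. t \<in> T \<Longrightarrow> continuous_map (unit_cube I) euclideanreal (\<lambda>w. h w t)"
  shows "\<exists>u\<in>topspace (unit_cube I). u \<noteq> z \<and> (\<forall>i\<in>D. u i = z i) \<and> (\<forall>t\<in>T. h u t = h z t)"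
proof -
  have "\<exists>F. finite F \<and> (\<forall>w\<in>topspace (unit_cube I).
      (\<forall>i\<in>F. w i = z i) \<longrightarrow> \<bar>h w t - h z t\<bar> < inverse (Suc n))" if "t \<in> T" for t n
    using unit_cube_finite_dependence[OF h[OF that] z, of "inverse (Suc n)"] by auto
  then obtain F where F: "\<And>t n. t \<in> T \<Longrightarrow> finite (F t n)"
    and Fd: "\<And>t n w. \<lbrakk>t \<in> T; w \<in> topspace (unit_cube I); \<forall>i\<in>F t n. w i = z i\<rbrakk>
      \<Longrightarrow> \<bar>h w t - h z t\<bar> < inverse (Suc n)"
    by metis
  define E where "E = (\<Union>(t, n)\<in>T \<times> (UNIV :: nat set). F t n)"
  have "|UNIV :: nat set| \<le>o |T|"
    using T(1) infinite_iff_card_of_nat by blast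
  then have "|T \<times> (UNIV :: nat set)| =o |T|"
    using card_of_Times_infinite[OF T(1)] by blast
  then have "|T \<times> (UNIV :: nat set)| <o |I|"
    using T(2) ordIso_ordLess_trans by blast
  then have "|E| <o |I|"
    unfolding E_def using F by (intro card_of_Union_finite_ordLess[OF I]) auto
  then have "|D \<union> E| <o |I|"
    using D I card_of_Un_ordLess_infinite by blast
  then have "\<not> I \<subseteq> D \<union> E"
    using card_of_mono1 not_ordLess_ordLeq by blast
  then obtain k where k: "k \<in> I" "k \<notin> D" "k \<notin> E"
    by blast
  define u where "u = z(k := if z k = 0 then 1 else 0)"
  have u: "u \<in> topspace (unit_cube I)"
    using z k by (auto simp: u_def topspace_unit_cube PiE_def Pi_def extensional_def)
  have "h u t = h z t" if t: "t \<in> T" for t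
  proof (rule ccontr)
    assume "h u t \<noteq> h z t"
    then obtain n where n: "inverse (real (Suc n)) < \<bar>h u t - h z t\<bar>"
      using reals_Archimedean[of "\<bar>h u t - h z t\<bar>"] by auto
    have "\<forall>i\<in>F t n. u i = z i"
      using k t by (auto simp: u_def E_def)
    then show False
      using Fd[OF t u] n by (meson less_asym)
  qed
  moreover have "u k \<noteq> z k"
    by (simp add: u_def)
  moreover have "\<forall>i\<in>D. u i = z i"
    using k by (auto simp: u_def)
  ultimately show ?thesis
    using u by (metis (no_types))
qed

text \<open>Counting coordinates is not enough when \<open>T\<close> is finite: if \<open>I\<close>
  is countable, the countably many relevant coordinates may exhaust it. Hence the separate use of
  invariance of domain.\<close>

lemma subcube_not_injective:
  assumes z: "z \<in> topspace (unit_cube I)" and I: "infinite I" and D: "|D| <o |I|" and T: "|T| <o |I|"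
    and h: "\<And>t. t \<in> T \<Longrightarrow> continuous_map (unit_cube I) euclideanreal (\<lambda>w. h w t)"
  shows "\<exists>u\<in>topspace (unit_cube I). \<exists>v\<in>topspace (unit_cube I).
    u \<noteq> v \<and> (\<forall>i\<in>I \<inter> D. u i = z i \<and> v i = z i) \<and> (\<forall>t\<in>T. h u t = h v t)"
proof (cases "finite T")
  case True
  have "infinite (I - D)"
  proof
    assume "finite (I - D)"
    then have "|(I - D) \<union> D| <o |I|"
      using I D by (metis card_of_Un_ordLess_infinite finite_ordLess_infinite2)
    then show False
      using card_of_mono1[of I "(I - D) \<union> D"] not_ordLess_ordLeq by blast
  qed
  then have "\<exists>u\<in>topspace (unit_cube I). \<exists>v\<in>topspace (unit_cube I).
    u \<noteq> v \<and> (\<forall>i\<in>I - (I - D). u i = z i \<and> v i = z i) \<and> (\<forall>t\<in>T. h u t = h v t)"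
    using h by (intro subcube_not_injective_finite[OF z _ _ True]) auto
  then show ?thesis
    by (simp add: Diff_Diff_Int)
next
  case False
  obtain u where "u \<in> topspace (unit_cube I)" "u \<noteq> z" "\<forall>i\<in>D. u i = z i" "\<forall>t\<in>T. h u t = h z t"
    using subcube_not_injective_infinite[where h = h, OF z I D False T h] by blast
  then show ?thesis
    using z by blast
qed

section \<open>Maximal families of witnesses for nonzero coordinates\<close>

lemma exists_large_support:
  fixes h :: "('i \<Rightarrow> real) \<Rightarrow> 'g \<Rightarrow> real"
  assumes I: "infinite I"
    and h: "\<And>\<gamma>. \<gamma> \<in> \<Gamma> \<Longrightarrow> continuous_map (unit_cube I) euclideanreal (\<lambda>w. h w \<gamma>)"
    and inj: "\<And>u v. \<lbrakk>u \<in> topspace (unit_cube I); v \<in> topspace (unit_cube I);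
      \<forall>\<gamma>\<in>\<Gamma>. h u \<gamma> = h v \<gamma>\<rbrakk> \<Longrightarrow> u = v"
  shows "\<exists>z\<in>topspace (unit_cube I). \<not> |{\<gamma> \<in> \<Gamma>. h z \<gamma> \<noteq> 0}| <o |I|"
proof (rule ccontr)
  assume "\<not> ?thesis"
  then have small: "|{\<gamma> \<in> \<Gamma>. h z \<gamma> \<noteq> 0}| <o |I|" if "z \<in> topspace (unit_cube I)" for z
    using that by blast
  let ?C = "topspace (unit_cube I)"
  \<comment> \<open>A triple certifies that \<gamma> lies in the support of every point of the cube
    agreeing with \<open>z\<close> on \<open>F\<close>.\<close>
  define Q where "Q = {(\<gamma>, F, z). \<gamma> \<in> \<Gamma> \<and> finite F \<and> F \<subseteq> I \<and> z \<in> ?C \<and>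
    (\<forall>w\<in>?C. (\<forall>i\<in>F. w i = z i) \<longrightarrow> h w \<gamma> \<noteq> 0)}"
  \<comment> \<open>Agreement on overlaps lets the witnesses be glued; distinct first components
    later give \<open>|M| = |T|\<close>.\<close>
  define R :: "'g \<times> 'i set \<times> ('i \<Rightarrow> real) \<Rightarrow> 'g \<times> 'i set \<times> ('i \<Rightarrow> real) \<Rightarrow> bool"
    where "R = (\<lambda>(\<gamma>, F, z) (\<gamma>', F', z'). \<gamma> \<noteq> \<gamma>' \<and> (\<forall>i\<in>F \<inter> F'. z i = z' i))"
  define P where "P = {G. G \<subseteq> Q \<and> pairwise R G}"
  have "\<forall>Ch\<in>chains P. \<Union>Ch \<in> P"
  proof
    fix Ch assume Ch: "Ch \<in> chains P"
    then have "chain\<^sub>\<subseteq> Ch" "Ch \<subseteq> P"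
      by (auto simp: chains_def)
    then have "pairwise R (\<Union>Ch)"
      by (intro pairwise_chain_Union) (auto simp: P_def)
    then show "\<Union>Ch \<in> P"
      using \<open>Ch \<subseteq> P\<close> by (auto simp: P_def)
  qed
  then obtain M where M: "M \<in> P" and max: "\<And>X. X \<in> P \<Longrightarrow> M \<subseteq> X \<Longrightarrow> X = M"
    using Zorn_Lemma[of P] by blast
  have MQ: "M \<subseteq> Q" and MR: "pairwise R M"
    using M by (auto simp: P_def)
  have MD: "\<gamma> \<in> \<Gamma>" "finite F" "F \<subseteq> I" "z \<in> ?C"
    "\<lbrakk>w \<in> ?C; \<forall>i\<in>F. w i = z i\<rbrakk> \<Longrightarrow> h w \<gamma> \<noteq> 0" if "(\<gamma>, F, z) \<in> M" for \<gamma> F z w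
    using subsetD[OF MQ that] by (auto simp: Q_def)
  have compat: "z i = z' i" if "(\<gamma>, F, z) \<in> M" "(\<gamma>', F', z') \<in> M" "i \<in> F" "i \<in> F'" for \<gamma> F z \<gamma>' F' z' i
  proof (cases "(\<gamma>, F, z) = (\<gamma>', F', z')")
    case False
    then have "R (\<gamma>, F, z) (\<gamma>', F', z')"
      using MR that by (simp add: pairwise_def)
    then show ?thesis
      using that by (simp add: R_def)
  qed simp
  \<comment> \<open>Pairwise compatibility gives one common value at each coordinate; where no
    witness constrains it, 0 serves.\<close>
  have "\<exists>v\<in>{0..1}. \<forall>(\<gamma>, F, z)\<in>M. i \<in> F \<longrightarrow> z i = v" if i: "i \<in> I" for i
  proof (cases "\<exists>\<gamma> F z. (\<gamma>, F, z) \<in> M \<and> i \<in> F")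
    case True
    then obtain \<gamma> F z where 1: "(\<gamma>, F, z) \<in> M" "i \<in> F"
      by blast
    then have "z i \<in> {0..1}"
      using unit_cube_mem[OF MD(4)] i by blast
    then show ?thesis
      using compat 1 by blast
  next
    case False
    then show ?thesis
      by (intro bexI[of _ 0]) auto
  qed
  then have "\<exists>v. \<forall>i\<in>I. v i \<in> {0..1} \<and> (\<forall>(\<gamma>, F, z)\<in>M. i \<in> F \<longrightarrow> z i = v i)"
    by (intro bchoice) (simp only: Bex_def, blast)
  then obtain v where v: "\<And>i. i \<in> I \<Longrightarrow> v i \<in> {0..1}"
    "\<And>i \<gamma> F z. \<lbrakk>i \<in> I; (\<gamma>, F, z) \<in> M; i \<in> F\<rbrakk> \<Longrightarrow> z i = v i"
    by fast
  define z0 where "z0 = restrict v I"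
  have z0: "z0 \<in> ?C"
    using v(1) by (auto simp: z0_def topspace_unit_cube simp del: atLeastAtMost_iff)
  define T where "T = fst ` M"
  define D where "D = (\<Union>m\<in>M. fst (snd m))"
  have DI: "D \<subseteq> I"
    using MD(3) by (fastforce simp: D_def)
  have agree: "w i = z i" if "\<forall>i\<in>D. w i = z0 i" "(\<gamma>, F, z) \<in> M" "i \<in> F" for w \<gamma> F z i
  proof -
    have "i \<in> D"
      using that by (force simp: D_def)
    then show ?thesis
      using that v(2) DI by (auto simp: z0_def)
  qed
  have supp: "{\<gamma> \<in> \<Gamma>. h w \<gamma> \<noteq> 0} = T" if w: "w \<in> ?C" "\<forall>i\<in>D. w i = z0 i" for w
  proof
    show "T \<subseteq> {\<gamma> \<in> \<Gamma>. h w \<gamma> \<noteq> 0}"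
    proof
      fix \<gamma> assume "\<gamma> \<in> T"
      then obtain F z where m: "(\<gamma>, F, z) \<in> M"
        by (auto simp: T_def)
      then show "\<gamma> \<in> {\<gamma> \<in> \<Gamma>. h w \<gamma> \<noteq> 0}"
        using MD(1,5)[OF m] agree[OF w(2) m] w(1) by blast
    qed
    show "{\<gamma> \<in> \<Gamma>. h w \<gamma> \<noteq> 0} \<subseteq> T"
    proof (rule subsetI, rule ccontr)
      fix \<gamma> assume "\<gamma> \<in> {\<gamma> \<in> \<Gamma>. h w \<gamma> \<noteq> 0}" and nT: "\<gamma> \<notin> T"
      then have \<gamma>: "\<gamma> \<in> \<Gamma>" "h w \<gamma> \<noteq> 0"
        by auto
      \<comment> \<open>With tolerance \<open>\<bar>h w \<gamma>\<bar>\<close> the value cannot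
        reach 0, so \<open>(\<gamma>, F, w)\<close> is a witness. As \<open>w\<close> agrees with
        \<open>z0\<close> on \<open>D\<close>, it is compatible with all of \<open>M\<close>,
        against maximality.\<close>
      obtain F where F: "finite F" "F \<subseteq> I"
        "\<forall>y\<in>?C. (\<forall>i\<in>F. y i = w i) \<longrightarrow> \<bar>h y \<gamma> - h w \<gamma>\<bar> < \<bar>h w \<gamma>\<bar>"
        using unit_cube_finite_dependence[OF h[OF \<gamma>(1)] w(1), of "\<bar>h w \<gamma>\<bar>"] \<gamma>(2) by auto
      have "h y \<gamma> \<noteq> 0" if "y \<in> ?C" "\<forall>i\<in>F. y i = w i" for y
      proof
        assume "h y \<gamma> = 0"
        then show False
          using F(3)[rule_format, OF that(1)] that(2) by simp
      qed
      then have "(\<gamma>, F, w) \<in> Q"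
        using F(1,2) \<gamma>(1) w(1) unfolding Q_def by blast
      moreover have "R (\<gamma>, F, w) m \<and> R m (\<gamma>, F, w)" if "m \<in> M" for m
      proof -
        obtain \<gamma>' F' z' where m: "m = (\<gamma>', F', z')"
          by (cases m) auto
        then have "\<gamma>' \<noteq> \<gamma>"
          using nT that by (force simp: T_def)
        then show ?thesis
          using agree[OF w(2)] that m by (auto simp: R_def)
      qed
      ultimately have "insert (\<gamma>, F, w) M \<in> P"
        using M by (auto simp: P_def pairwise_insert)
      then have "(\<gamma>, F, w) \<in> M"
        using max by blast
      then show False
        using nT by (force simp: T_def)
    qed
  qed
  \<comment> \<open>The glued point \<open>z0\<close> has support exactly \<open>T\<close>, so the
    assumed smallness of supports bounds \<open>T\<close>.\<close>
  have T: "|T| <o |I|"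
    using small[OF z0] supp[OF z0] by simp
  have "inj_on fst M"
  proof (rule inj_onI, rule ccontr)
    fix m m' assume m: "m \<in> M" "m' \<in> M" "fst m = fst m'" "m \<noteq> m'"
    then have "R m m'"
      using MR by (simp add: pairwise_def)
    then show False
      using m(3) by (auto simp: R_def split: prod.splits)
  qed
  then have "bij_betw fst M T"
    by (simp add: T_def bij_betw_def)
  then have "|M| =o |T|"
    using card_of_ordIsoI by blast
  then have "|M| <o |I|"
    using T ordIso_ordLess_trans by blast
  then have D: "|D| <o |I|"
    unfolding D_def using MD(2) by (intro card_of_Union_finite_ordLess[OF I]) auto
  have "T \<subseteq> \<Gamma>"
    using MD(1) by (auto simp: T_def)
  then have "\<And>t. t \<in> T \<Longrightarrow> continuous_map (unit_cube I) euclideanreal (\<lambda>w. h w t)"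
    using h by blast
  from subcube_not_injective[where h = h, OF z0 I D T this]
  obtain u v where uv: "u \<in> ?C" "v \<in> ?C" "u \<noteq> v"
    "\<forall>i\<in>I \<inter> D. u i = z0 i \<and> v i = z0 i" "\<forall>t\<in>T. h u t = h v t"
    by blast
  \<comment> \<open>Both points extend all witnesses, so both images vanish off \<open>T\<close>;
    agreement on \<open>T\<close> then becomes agreement on \<Gamma>.\<close>
  have supp_uv: "{\<gamma> \<in> \<Gamma>. h u \<gamma> \<noteq> 0} = T" "{\<gamma> \<in> \<Gamma>. h v \<gamma> \<noteq> 0} = T"
    using uv(4) DI by (intro supp uv(1,2); blast)+
  have "h u \<gamma> = h v \<gamma>" if "\<gamma> \<in> \<Gamma>" for \<gamma>
  proof (cases "\<gamma> \<in> T")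
    case False
    then have "h u \<gamma> = 0" "h v \<gamma> = 0"
      using supp_uv that by blast+
    then show ?thesis
      by simp
  qed (use uv in blast)
  then show False
    using inj uv by blast
qed

section \<open>From a homeomorphism to its coordinate functions\<close>

theorem corollary7p2:
  fixes \<kappa> :: "'k rel"
  assumes "Card_order \<kappa>" and "cinfinite \<kappa>"
  shows "\<not> kappa_Corson_compact TYPE('g) \<kappa> (unit_cube (Field \<kappa>))"
proof
  let ?I = "Field \<kappa>"
  assume "kappa_Corson_compact TYPE('g) \<kappa> (unit_cube ?I)"
  then obtain \<Gamma> :: "'g set" and S where S: "S \<subseteq> Sigma_set \<kappa> \<Gamma>"
    and "unit_cube ?I homeomorphic_space subtopology (Sigma_space \<kappa> \<Gamma>) S"
    by (auto simp: kappa_Corson_compact_def)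
  then obtain h where hom: "homeomorphic_map (unit_cube ?I) (subtopology (Sigma_space \<kappa> \<Gamma>) S) h"
    using homeomorphic_space by blast
  have inj: "inj_on h (topspace (unit_cube ?I))"
    using hom homeomorphic_map_def homeomorphic_eq_everything_map by blast
  have cont: "continuous_map (unit_cube ?I) (subtopology (Sigma_space \<kappa> \<Gamma>) S) h"
    using hom homeomorphic_imp_continuous_map by blast
  then have c: "continuous_map (unit_cube ?I) (product_topology (\<lambda>_. euclideanreal) \<Gamma>) h"
    by (auto simp: Sigma_space_def continuous_map_in_subtopology)
  have hS: "h w \<in> Sigma_set \<kappa> \<Gamma>" if "w \<in> topspace (unit_cube ?I)" for w
    using cont S that by (auto simp: continuous_map_in_subtopology)
  have card: "|?I| =o \<kappa>"
    using assms(1) by (rule card_of_Field_ordIso)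
  have "\<exists>z\<in>topspace (unit_cube ?I). \<not> |{\<gamma> \<in> \<Gamma>. h z \<gamma> \<noteq> 0}| <o |?I|"
  proof (rule exists_large_support)
    show "infinite ?I"
      using assms(2) by (simp add: cinfinite_def)
    show "continuous_map (unit_cube ?I) euclideanreal (\<lambda>w. h w \<gamma>)" if "\<gamma> \<in> \<Gamma>" for \<gamma>
      using c that by (auto simp: continuous_map_componentwise)
    show "u = v" if "u \<in> topspace (unit_cube ?I)" "v \<in> topspace (unit_cube ?I)"
      "\<forall>\<gamma>\<in>\<Gamma>. h u \<gamma> = h v \<gamma>" for u v
    proof -
      \<comment> \<open>Points of \<open>Sigma_set\<close> are extensional, so agreement on \<Gamma>
        is equality.\<close>
      have "h u = h v"
        using hS[OF that(1)] hS[OF that(2)] that(3)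
        by (intro PiE_ext[of _ \<Gamma> "\<lambda>_. UNIV"]) (auto simp: Sigma_set_def)
      then show ?thesis
        using inj that by (auto dest: inj_onD)
    qed
  qed
  then obtain z where "z \<in> topspace (unit_cube ?I)" "\<not> |{\<gamma> \<in> \<Gamma>. h z \<gamma> \<noteq> 0}| <o |?I|"
    by blast
  moreover have "|{\<gamma> \<in> \<Gamma>. h z \<gamma> \<noteq> 0}| <o \<kappa>"
    using hS[OF \<open>z \<in> _\<close>] by (simp add: Sigma_set_def)
  ultimately show False
    using card ordIso_symmetric ordLess_ordIso_trans by blast
qed

end
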